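(* $\mathsf{DNR}_k\equiv^{<\omega}_\omega\mathsf{DNR}_2$ for any $k\ge2$. Indeed, for any $k\in\mathbb N$, the direction $\mathsf{DNR}_k\le^{<\omega}_\omega\mathsf{DNR}_{k^2}$ is witnessed by a team consisting of a confident learner and an eventually-Popperian learner; that is, there are a confident learner $\Psi_0$ and an eventually-Popperian learner $\Psi_1$ such that for every $g\in\mathsf{DNR}_{k^2}$ there is $i\in\{0,1\}$ for which $\lim_n\Psi_i(g\upharpoonright n)$ exists and $\Phi_{\lim_n\Psi_i(g\upharpoonright n)}(g)\in\mathsf{DNR}_k$. In particular, $\mathsf{DNR}_k\equiv^\omega_1\mathsf{DNR}_2$ for any $k\ge2$.
   Context: $\mathsf{DNR}_k$ is the set of all $k$-valued diagonally noncomputable functions, i.e. all total $f:\mathbb N\to\mathbb N$ with $f(n)<k$ for every $n$ and $f(e)\neq\Phi_e(e)$ whenever $\Phi_e(e)$ converges (here $\Phi_e(e)$ is the value of the $e$-th partial computable function on $\mathbb N$ at $e$). Let also $\{\Phi_e\}_{e\in\mathbb N}$ denote an effective enumeration of all partial computable functions $\Phi_e:\subseteq\mathbb N^{\mathbb N}\to\mathbb N^{\mathbb N}$. A learner is a total computable function $\Psi:\mathbb N^{<\mathbb N}\to\mathbb N$; let $\{\Psi^*_e\}_{e\in\mathbb N}$ be an effective enumeration of all learners. A learner $\Psi$ is confident if $\lim_n\Psi(f\upharpoonright n)$ converges for every $f\in\mathbb N^{\mathbb N}$. A learner $\Psi$ is eventually-Popperian if, for every $f\in\mathbb N^{\mathbb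 N}$, $\Phi_{\lim_n\Psi(f\upharpoonright n)}(f)$ is total whenever $\lim_n\Psi(f\upharpoonright n)$ converges. A partial function $\Gamma:\subseteq\mathbb N^{\mathbb N}\to\mathbb N^{\mathbb N}$ is $(<\omega,\omega)$-computable if there is $b\in\mathbb N$ such that for every $g\in\mathrm{dom}(\Gamma)$ there is $e<b$ such that $\lim_n\Psi^*_e(g\upharpoonright n)$ exists and $\Phi_{\lim_n\Psi^*_e(g\upharpoonright n)}(g)=\Gamma(g)$. $\Gamma$ is $(\omega,1)$-computable if $\Gamma(g)\le_Tg$ for every $g\in\mathrm{dom}(\Gamma)$. For $A,B\subseteq\mathbb N^{\mathbb N}$, $A\le^\alpha_\beta B$ means there is an $(\alpha,\beta)$-computable $\Gamma$ with $B\subseteq\mathrm{dom}(\Gamma)$ and $\Gamma(g)\in A$ for every $g\in B$; $A\equiv^\alpha_\beta B$ means $A\le^\alpha_\beta B$ and $B\le^\alpha_\beta A$. *)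

theory Defs
  imports Complex_Main "HOL-Library.Nat_Bijection"
begin

section \<open>Oracle computability\<close>

text \<open>
  Programs for the partial functions from \<open>nat\<close> to \<open>nat\<close> that are recursive in an oracle
  \<open>g\<close>. All programs are unary; several arguments are packed with the Cantor pairing
  \<^const>\<open>prod_encode\<close>, which \<open>Fst\<close>, \<open>Snd\<close> and \<open>Tup\<close> make available.
\<close>

datatype prog =
    Zero | Succ | Fst | Snd | Query
  | Tup prog prog
  | Comp prog prog
  | PrimRec prog prog
  | Mu prog

text \<open>\<open>None\<close> stands for divergence.\<close>

primrec run :: "prog \<Rightarrow> (nat \<Rightarrow> nat) \<Rightarrow> nat \<Rightarrow> nat option" where
  "run Zero g x = Some 0"
| "run Succ g x = Some (Suc x)"
| "run Fst g x = Some (fst (prod_decode x))"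
| "run Snd g x = Some (snd (prod_decode x))"
| "run Query g x = Some (g x)"
| "run (Tup p q) g x =
     Option.bind (run p g x) (\<lambda>a. Option.bind (run q g x) (\<lambda>b. Some (prod_encode (a, b))))"
| "run (Comp p q) g x = Option.bind (run q g x) (run p g)"
| "run (PrimRec p q) g x =
     (let (a, n) = prod_decode x in
      rec_nat (run p g a)
        (\<lambda>m r. Option.bind r (\<lambda>y. run q g (prod_encode (a, prod_encode (m, y))))) n)"
| "run (Mu p) g x =
     (if \<exists>n. run p g (prod_encode (x, n)) = Some 0 \<and>
             (\<forall>m<n. run p g (prod_encode (x, m)) \<noteq> None)
      then Some (LEAST n. run p g (prod_encode (x, n)) = Some 0)
      else None)"

text \<open>An effective bijective numbering of the programs.\<close>

function prog_of_nat :: "nat \<Rightarrow> prog" where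
  "prog_of_nat e =
    (if e = 0 then Zero
     else if e = 1 then Succ
     else if e = 2 then Fst
     else if e = 3 then Snd
     else if e = 4 then Query
     else
       (let m = (e - 5) div 4; r = (e - 5) mod 4;
            a = fst (prod_decode m); b = snd (prod_decode m) in
        if r = 0 then Tup (prog_of_nat a) (prog_of_nat b)
        else if r = 1 then Comp (prog_of_nat a) (prog_of_nat b)
        else if r = 2 then PrimRec (prog_of_nat a) (prog_of_nat b)
        else Mu (prog_of_nat m)))"
  by pat_completeness auto

lemma prod_decode_le:
  "fst (prod_decode m) \<le> m" "snd (prod_decode m) \<le> m"
  using le_prod_encode_1[of "fst (prod_decode m)" "snd (prod_decode m)"]
    le_prod_encode_2[of "snd (prod_decode m)" "fst (prod_decode m)"]
  by simp_all

termination prog_of_nat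
proof (relation "Wellfounded.measure id", goal_cases)
  case 1
  then show ?case by simp
qed (use prod_decode_le in \<open>auto intro!: le_less_trans[OF prod_decode_le(1)]
      le_less_trans[OF prod_decode_le(2)]\<close>)

declare prog_of_nat.simps [simp del]

lemma prog_of_nat_compound:
  "prog_of_nat (5 + 4 * prod_encode (a, b)) = Tup (prog_of_nat a) (prog_of_nat b)"
  "prog_of_nat (6 + 4 * prod_encode (a, b)) = Comp (prog_of_nat a) (prog_of_nat b)"
  "prog_of_nat (7 + 4 * prod_encode (a, b)) = PrimRec (prog_of_nat a) (prog_of_nat b)"
  "prog_of_nat (8 + 4 * m) = Mu (prog_of_nat m)"
proof -
  have *: "(4 * n + r) div 4 = n" "(4 * n + r) mod 4 = r" if "r < 4" for n r :: nat
    using that by auto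
  show "prog_of_nat (5 + 4 * prod_encode (a, b)) = Tup (prog_of_nat a) (prog_of_nat b)"
    by (subst prog_of_nat.simps) simp
  show "prog_of_nat (6 + 4 * prod_encode (a, b)) = Comp (prog_of_nat a) (prog_of_nat b)"
    using *[of 1 "prod_encode (a, b)"]
    by (subst prog_of_nat.simps) (simp add: Let_def)
  show "prog_of_nat (7 + 4 * prod_encode (a, b)) = PrimRec (prog_of_nat a) (prog_of_nat b)"
    using *[of 2 "prod_encode (a, b)"]
    by (subst prog_of_nat.simps) (simp add: Let_def add.commute)
  show "prog_of_nat (8 + 4 * m) = Mu (prog_of_nat m)"
    using *[of 3 m]
    by (subst prog_of_nat.simps) (simp add: Let_def add.commute)
qed

lemma surj_prog_of_nat: "surj prog_of_nat"
proof -
  have "\<exists>e. prog_of_nat e = p" for p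
  proof (induction p)
    case Zero show ?case by (rule exI[of _ 0]) (simp add: prog_of_nat.simps)
  next
    case Succ show ?case by (rule exI[of _ 1]) (simp add: prog_of_nat.simps)
  next
    case Fst show ?case by (rule exI[of _ 2]) (simp add: prog_of_nat.simps)
  next
    case Snd show ?case by (rule exI[of _ 3]) (simp add: prog_of_nat.simps)
  next
    case Query show ?case by (rule exI[of _ 4]) (simp add: prog_of_nat.simps)
  qed (metis prog_of_nat_compound)+
  then show ?thesis by (metis surjI)
qed

text \<open>
  The \<open>e\<close>-th partial computable function on the natural numbers: the \<open>e\<close>-th program run
  with the constantly zero (i.e. empty) oracle.
\<close>

definition phi :: "nat \<Rightarrow> nat \<Rightarrow> nat option" where
  "phi e n = run (prog_of_nat e) (\<lambda>_. 0) n"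

type_synonym baire = "nat \<Rightarrow> nat"

text \<open>
  The \<open>e\<close>-th partial computable function on Baire space. Its domain consists of those \<open>g\<close>
  for which the \<open>e\<close>-th program with oracle \<open>g\<close> halts on every input.
\<close>

definition Phi :: "nat \<Rightarrow> baire \<Rightarrow> baire option" where
  "Phi e g =
     (if \<forall>n. run (prog_of_nat e) g n \<noteq> None
      then Some (\<lambda>n. the (run (prog_of_nat e) g n)) else None)"

definition turing_le :: "baire \<Rightarrow> baire \<Rightarrow> bool"  (infix "\<le>\<^sub>T" 50) where
  "f \<le>\<^sub>T g \<longleftrightarrow> (\<exists>e. Phi e g = Some f)"


section \<open>Learners\<close>

definition initial_seg :: "baire \<Rightarrow> nat \<Rightarrow> nat list"  (infix "\<restriction>" 80) where
  "f \<restriction> n = map f [0..<n]"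

definition learner :: "(nat list \<Rightarrow> nat) \<Rightarrow> bool" where
  "learner \<Psi> \<longleftrightarrow> (\<exists>e. \<forall>\<sigma>. phi e (list_encode \<sigma>) = Some (\<Psi> \<sigma>))"

text \<open>
  Limits of learners are taken in the discrete topology of \<^typ>\<open>nat\<close>, i.e. convergence
  means being eventually constant.
\<close>

definition confident :: "(nat list \<Rightarrow> nat) \<Rightarrow> bool" where
  "confident \<Psi> \<longleftrightarrow> (\<forall>f::baire. convergent (\<lambda>n. \<Psi> (f \<restriction> n)))"

definition eventually_popperian :: "(nat list \<Rightarrow> nat) \<Rightarrow> bool" where
  "eventually_popperian \<Psi> \<longleftrightarrow>
     (\<forall>f::baire. convergent (\<lambda>n. \<Psi> (f \<restriction> n)) \<longrightarrow> f \<in> dom (Phi (lim (\<lambda>n. \<Psi> (f \<restriction> n)))))"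

text \<open>
  Learners are enumerated by program index, with indices of non-total functions sent to the
  constant learner 0. By diagonalization, no enumeration of exactly the total computable
  functions is uniformly computable in the index; the notions below depend on the enumeration
  only through its range (see \<open>range_learner_enum\<close> and \<open>team_computable_iff_finite\<close>).
\<close>

definition learner_enum :: "nat \<Rightarrow> nat list \<Rightarrow> nat" where
  "learner_enum e =
     (if \<forall>\<sigma>. phi e (list_encode \<sigma>) \<noteq> None
      then (\<lambda>\<sigma>. the (phi e (list_encode \<sigma>))) else (\<lambda>_. 0))"

lemma range_learner_enum: "range learner_enum = Collect learner"
proof (intro set_eqI iffI)
  fix \<Psi> assume "\<Psi> \<in> range learner_enum"
  then obtain e where e: "\<Psi> = learner_enum e" by blast
  have "learner (\<lambda>_. 0)"
    unfolding learner_def phi_def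
    by (rule exI[of _ 0]) (simp add: prog_of_nat.simps)
  then show "\<Psi> \<in> Collect learner"
    unfolding e learner_enum_def by (auto simp: learner_def intro!: exI[of _ e])
next
  fix \<Psi> assume "\<Psi> \<in> Collect learner"
  then obtain e where "\<forall>\<sigma>. phi e (list_encode \<sigma>) = Some (\<Psi> \<sigma>)"
    by (auto simp: learner_def)
  then have "\<Psi> = learner_enum e" by (auto simp: learner_enum_def)
  then show "\<Psi> \<in> range learner_enum" by blast
qed


section \<open>Reducibilities between mass problems\<close>

text \<open>\<open>(<\<omega>,\<omega>)\<close>-computability.\<close>

definition team_computable :: "(baire \<Rightarrow> baire option) \<Rightarrow> bool" where
  "team_computable \<Gamma> \<longleftrightarrow>
     (\<exists>b::nat. \<forall>g\<in>dom \<Gamma>. \<exists>e<b.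
        convergent (\<lambda>n. learner_enum e (g \<restriction> n)) \<and>
        Phi (lim (\<lambda>n. learner_enum e (g \<restriction> n))) g = \<Gamma> g)"

lemma team_computable_iff_finite:
  "team_computable \<Gamma> \<longleftrightarrow>
     (\<exists>L. finite L \<and> L \<subseteq> Collect learner \<and>
        (\<forall>g\<in>dom \<Gamma>. \<exists>\<Psi>\<in>L. convergent (\<lambda>n. \<Psi> (g \<restriction> n)) \<and>
           Phi (lim (\<lambda>n. \<Psi> (g \<restriction> n))) g = \<Gamma> g))"
    (is "_ \<longleftrightarrow> (\<exists>L. ?P L)")
proof
  assume "team_computable \<Gamma>"
  then obtain b where
    "\<forall>g\<in>dom \<Gamma>. \<exists>e<b. convergent (\<lambda>n. learner_enum e (g \<restriction> n)) \<and>
       Phi (lim (\<lambda>n. learner_enum e (g \<restriction> n))) g = \<Gamma> g"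
    unfolding team_computable_def by blast
  then have "?P (learner_enum ` {..<b})"
    using range_learner_enum by fastforce
  then show "\<exists>L. ?P L" ..
next
  assume "\<exists>L. ?P L"
  then obtain L where L: "?P L" ..
  then obtain E where E: "finite E" "L = learner_enum ` E"
    using finite_subset_image[of L learner_enum UNIV] range_learner_enum by auto
  then obtain b where "\<forall>e\<in>E. e < b"
    using finite_nat_set_iff_bounded by blast
  with L E show "team_computable \<Gamma>"
    unfolding team_computable_def by (intro exI[of _ b]) blast
qed

text \<open>\<open>(\<omega>,1)\<close>-computability.\<close>

definition nonuniformly_computable :: "(baire \<Rightarrow> baire option) \<Rightarrow> bool" where
  "nonuniformly_computable \<Gamma> \<longleftrightarrow> (\<forall>g\<in>dom \<Gamma>. the (\<Gamma> g) \<le>\<^sub>T g)"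

definition reducible_via ::
    "((baire \<Rightarrow> baire option) \<Rightarrow> bool) \<Rightarrow> baire set \<Rightarrow> baire set \<Rightarrow> bool" where
  "reducible_via C A B \<longleftrightarrow> (\<exists>\<Gamma>. C \<Gamma> \<and> B \<subseteq> dom \<Gamma> \<and> (\<forall>g\<in>B. the (\<Gamma> g) \<in> A))"

abbreviation team_le :: "baire set \<Rightarrow> baire set \<Rightarrow> bool"
    (infix "\<le>\<^bsup><\<omega>\<^esup>\<^sub>\<omega>" 50) where
  "A \<le>\<^bsup><\<omega>\<^esup>\<^sub>\<omega> B \<equiv> reducible_via team_computable A B"

abbreviation team_equiv :: "baire set \<Rightarrow> baire set \<Rightarrow> bool"
    (infix "\<equiv>\<^bsup><\<omega>\<^esup>\<^sub>\<omega>" 50) where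
  "A \<equiv>\<^bsup><\<omega>\<^esup>\<^sub>\<omega> B \<equiv> A \<le>\<^bsup><\<omega>\<^esup>\<^sub>\<omega> B \<and> B \<le>\<^bsup><\<omega>\<^esup>\<^sub>\<omega> A"

abbreviation nonuniform_le :: "baire set \<Rightarrow> baire set \<Rightarrow> bool"
    (infix "\<le>\<^sup>\<omega>\<^sub>1" 50) where
  "A \<le>\<^sup>\<omega>\<^sub>1 B \<equiv> reducible_via nonuniformly_computable A B"

abbreviation nonuniform_equiv :: "baire set \<Rightarrow> baire set \<Rightarrow> bool"
    (infix "\<equiv>\<^sup>\<omega>\<^sub>1" 50) where
  "A \<equiv>\<^sup>\<omega>\<^sub>1 B \<equiv> A \<le>\<^sup>\<omega>\<^sub>1 B \<and> B \<le>\<^sup>\<omega>\<^sub>1 A"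


section \<open>Diagonally noncomputable functions\<close>

definition DNR :: "nat \<Rightarrow> baire set" where
  "DNR k = {f. (\<forall>n. f n < k) \<and> (\<forall>e. phi e e \<noteq> Some (f e))}"

end

theory Submission
  imports Defs
begin

text \<open>
  Let \<open>g \<in> DNR (k ^ m)\<close>. A tuple \<open>c = (e\<^sub>0, \<dots>, e\<^sub>m\<^sub>-\<^sub>1)\<close> effectively determines an index \<open>q c\<close> of the
  constant function with value \<open>\<Sum>l<m. k ^ l * phi e\<^sub>l e\<^sub>l\<close>, so for every \<open>c\<close> some base-\<open>k\<close> digit of
  \<open>g (q c)\<close> differs from the corresponding \<open>phi e\<^sub>l e\<^sub>l\<close>. Let \<open>Q j\<close> say that every choice of
  \<open>e\<^sub>0, \<dots>, e\<^sub>j\<^sub>-\<^sub>1\<close> extends to a tuple all of whose digits from position \<open>j\<close> on do agree. Then \<open>Q m\<close> holds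
  and \<open>Q 0\<close> fails, hence \<open>Q (j + 1)\<close> holds and \<open>Q j\<close> fails for some \<open>j < m\<close>. Fix \<open>e\<^sub>0, \<dots>, e\<^sub>j\<^sub>-\<^sub>1\<close>
  witnessing the failure of \<open>Q j\<close>. Given \<open>x\<close>, search an extension \<open>c\<close> with \<open>e\<^sub>j = x\<close> that agrees from
  position \<open>j + 1\<close> on and return digit \<open>j\<close> of \<open>g (q c)\<close>: this is a \<open>k\<close>-valued diagonally noncomputable
  function. A witness for the failure of \<open>Q j\<close> can be learned in the limit, since wrong guesses are
  refuted at a finite stage. Thus \<open>m\<close> learners suffice, which avoids composing team reductions in
  passing from \<open>2 ^ k\<close> values to \<open>2\<close>. For \<open>m = 2\<close>, the case \<open>j = 0\<close> involves no guess at all, and in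
  the case \<open>j = 1\<close> the search is trivial, so that the conjectured functions are total on every oracle.
\<close>

section \<open>Oracle computable functions\<close>

definition pair :: "nat \<Rightarrow> nat \<Rightarrow> nat" where "pair a b = prod_encode (a, b)"
definition pfst :: "nat \<Rightarrow> nat" where "pfst n = fst (prod_decode n)"
definition psnd :: "nat \<Rightarrow> nat" where "psnd n = snd (prod_decode n)"

lemma pfst_pair [simp]: "pfst (pair a b) = a"
  and psnd_pair [simp]: "psnd (pair a b) = b"
  by (simp_all add: pair_def pfst_def psnd_def)

lemma pair_pfst_psnd [simp]: "pair (pfst n) (psnd n) = n"
  by (simp add: pair_def pfst_def psnd_def)

lemma pfst_le: "pfst n \<le> n" and psnd_le: "psnd n \<le> n"
  by (simp_all add: pfst_def psnd_def prod_decode_le)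

lemma le_pair: "a \<le> pair a b" "b \<le> pair a b"
  by (simp_all add: pair_def le_prod_encode_1 le_prod_encode_2)

text \<open>One program has to serve all oracles and halt on every input. Computability of a
  compound term then follows from its shape by the closure rules \<open>comp_intros\<close>.\<close>

definition comp_fun :: "(baire \<Rightarrow> nat \<Rightarrow> nat) \<Rightarrow> bool" where
  "comp_fun F \<longleftrightarrow> (\<exists>p. \<forall>g x. run p g x = Some (F g x))"

definition comp_pred :: "(baire \<Rightarrow> nat \<Rightarrow> bool) \<Rightarrow> bool" where
  "comp_pred P \<longleftrightarrow> comp_fun (\<lambda>g x. of_bool (P g x))"

named_theorems comp_intros

lemma comp_fun_id [comp_intros]: "comp_fun (\<lambda>g x. x)"
  unfolding comp_fun_def by (rule exI[of _ "Tup Fst Snd"]) simp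

lemma comp_fun_Suc [comp_intros]: "comp_fun F \<Longrightarrow> comp_fun (\<lambda>g x. Suc (F g x))"
  unfolding comp_fun_def by (elim exE, rule_tac x = "Comp Succ p" in exI) simp

lemma comp_fun_const [comp_intros]: "comp_fun (\<lambda>g x. c)"
proof (induction c)
  case 0
  show ?case unfolding comp_fun_def by (rule exI[of _ Zero]) simp
qed (rule comp_fun_Suc)

lemma comp_fun_query [comp_intros]: "comp_fun F \<Longrightarrow> comp_fun (\<lambda>g x. g (F g x))"
  unfolding comp_fun_def by (elim exE, rule_tac x = "Comp Query p" in exI) simp

lemma comp_fun_pfst [comp_intros]: "comp_fun F \<Longrightarrow> comp_fun (\<lambda>g x. pfst (F g x))"
  unfolding comp_fun_def by (elim exE, rule_tac x = "Comp Fst p" in exI) (simp add: pfst_def)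

lemma comp_fun_psnd [comp_intros]: "comp_fun F \<Longrightarrow> comp_fun (\<lambda>g x. psnd (F g x))"
  unfolding comp_fun_def by (elim exE, rule_tac x = "Comp Snd p" in exI) (simp add: psnd_def)

lemma comp_fun_pair [comp_intros]:
  "comp_fun F \<Longrightarrow> comp_fun G \<Longrightarrow> comp_fun (\<lambda>g x. pair (F g x) (G g x))"
  unfolding comp_fun_def
  by (elim exE, rule_tac x = "Tup p pa" in exI) (simp add: pair_def)

lemma comp_fun_comp:
  assumes "comp_fun F" "comp_fun G"
  shows "comp_fun (\<lambda>g x. F g (G g x))"
  using assms unfolding comp_fun_def by (elim exE, rule_tac x = "Comp p pa" in exI) simp

lemma comp_fun_comp2:
  assumes "comp_fun (\<lambda>g x. H g (pfst x) (psnd x))" "comp_fun F" "comp_fun G"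
  shows "comp_fun (\<lambda>g x. H g (F g x) (G g x))"
  using comp_fun_comp[OF assms(1) comp_fun_pair[OF assms(2,3)]] by simp

text \<open>\<open>PrimRec\<close> recurses on the second half of its input and passes the first
  half to both programs. Taking \<open>x\<close> itself as that parameter lets base and step depend
  on it.\<close>

lemma comp_fun_rec [comp_intros]:
  assumes "comp_fun A" "comp_fun (\<lambda>g y. S g (pfst y) (pfst (psnd y)) (psnd (psnd y)))" "comp_fun N"
  shows "comp_fun (\<lambda>g x. rec_nat (A g x) (S g x) (N g x))"
proof -
  obtain p q where p: "\<And>g x. run p g x = Some (A g x)"
    and q: "\<And>g y. run q g y = Some (S g (pfst y) (pfst (psnd y)) (psnd (psnd y)))"
    using assms unfolding comp_fun_def by metis
  have step: "run q g (prod_encode (x, prod_encode (m, r))) = Some (S g x m r)" for g x m r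
    using q[of g "pair x (pair m r)"] by (simp add: pair_def pfst_def psnd_def)
  have "run (PrimRec p q) g (pair x n) = Some (rec_nat (A g x) (S g x) n)" for g x n
    by (induction n) (simp_all add: pair_def p step)
  then have "run (PrimRec p q) g y = Some (rec_nat (A g (pfst y)) (S g (pfst y)) (psnd y))" for g y
    by (metis pair_pfst_psnd)
  then have "comp_fun (\<lambda>g y. rec_nat (A g (pfst y)) (S g (pfst y)) (psnd y))"
    unfolding comp_fun_def by blast
  from comp_fun_comp2[OF this comp_fun_id assms(3)] show ?thesis .
qed


section \<open>Closure under arithmetic and Boolean operations\<close>

lemma comp_fun_add [comp_intros]:
  assumes F: "comp_fun F" and G: "comp_fun G"
  shows "comp_fun (\<lambda>g x. F g x + G g x)"
proof -
  have eq: "a + b = rec_nat a (\<lambda>_ r. Suc r) b" for a b :: nat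
    by (induction b) auto
  show ?thesis unfolding eq by (intro comp_intros F G)
qed

lemma comp_fun_mult [comp_intros]:
  assumes F: "comp_fun F" and G: "comp_fun G"
  shows "comp_fun (\<lambda>g x. F g x * G g x)"
proof -
  have eq: "a * b = rec_nat 0 (\<lambda>_ r. r + a) b" for a b :: nat
    by (induction b) auto
  show ?thesis unfolding eq by (intro comp_intros F G comp_fun_comp[OF F])
qed

lemma comp_fun_diff [comp_intros]:
  assumes F: "comp_fun F" and G: "comp_fun G"
  shows "comp_fun (\<lambda>g x. F g x - G g x)"
proof -
  have pred: "a - 1 = rec_nat 0 (\<lambda>m r. m) a" for a :: nat
    by (cases a) auto
  have "comp_fun (\<lambda>g y. psnd (psnd y) - 1)"
    unfolding pred by (intro comp_intros)
  then have "comp_fun (\<lambda>g x. rec_nat (F g x) (\<lambda>_ r. r - 1) (G g x))"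
    by (intro comp_intros F G)
  \<comment> \<open>As a rewrite rule this equation would loop, since its right side contains a
    subtraction; hence it is used backwards.\<close>
  moreover have eq: "a - b = rec_nat a (\<lambda>_ r. r - 1) b" for a b :: nat
    by (induction b) auto
  ultimately show ?thesis unfolding eq[symmetric] by blast
qed

lemma comp_pred_less [comp_intros]:
  assumes F: "comp_fun F" and G: "comp_fun G"
  shows "comp_pred (\<lambda>g x. F g x < G g x)"
proof -
  have eq: "of_bool (a < b) = 1 - (Suc a - b)" for a b :: nat
    by auto
  show ?thesis unfolding comp_pred_def eq by (intro comp_intros F G)
qed

lemma comp_pred_not [comp_intros]:
  assumes P: "comp_pred P"
  shows "comp_pred (\<lambda>g x. \<not> P g x)"
proof -
  have eq: "of_bool (\<not> b) = 1 - (of_bool b :: nat)" for b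
    by simp
  show ?thesis unfolding comp_pred_def eq
    by (intro comp_intros P[unfolded comp_pred_def])
qed

lemma comp_pred_conj [comp_intros]:
  "comp_pred P \<Longrightarrow> comp_pred Q \<Longrightarrow> comp_pred (\<lambda>g x. P g x \<and> Q g x)"
  unfolding comp_pred_def of_bool_conj by (rule comp_fun_mult)

lemma comp_pred_comp2:
  "comp_pred (\<lambda>g x. P g (pfst x) (psnd x)) \<Longrightarrow> comp_fun F \<Longrightarrow> comp_fun G \<Longrightarrow>
    comp_pred (\<lambda>g x. P g (F g x) (G g x))"
  unfolding comp_pred_def by (rule comp_fun_comp2)

lemma comp_pred_disj [comp_intros]:
  assumes "comp_pred P" "comp_pred Q"
  shows "comp_pred (\<lambda>g x. P g x \<or> Q g x)"
proof -
  have "comp_pred (\<lambda>g x. \<not> (\<not> P g x \<and> \<not> Q g x))"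
    by (intro comp_intros assms)
  then show ?thesis by simp
qed

lemma comp_pred_imp [comp_intros]:
  assumes "comp_pred P" "comp_pred Q"
  shows "comp_pred (\<lambda>g x. P g x \<longrightarrow> Q g x)"
  unfolding imp_conv_disj by (intro comp_intros assms)

lemma comp_pred_le [comp_intros]:
  "comp_fun F \<Longrightarrow> comp_fun G \<Longrightarrow> comp_pred (\<lambda>g x. F g x \<le> G g x)"
  unfolding less_Suc_eq_le[symmetric] by (intro comp_intros)

lemma comp_pred_eq [comp_intros]:
  fixes F G :: "baire \<Rightarrow> nat \<Rightarrow> nat"
  shows "comp_fun F \<Longrightarrow> comp_fun G \<Longrightarrow> comp_pred (\<lambda>g x. F g x = G g x)"
  unfolding order_eq_iff by (intro comp_intros)

lemma comp_fun_if [comp_intros]: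
  assumes "comp_pred P" "comp_fun F" "comp_fun G"
  shows "comp_fun (\<lambda>g x. if P g x then F g x else G g x)"
proof -
  have eq: "(if b then u else v) = of_bool b * u + (1 - of_bool b) * v" for b and u v :: nat
    by simp
  show ?thesis unfolding eq
    by (intro comp_intros assms assms(1)[unfolded comp_pred_def])
qed

section \<open>Unbounded and bounded search\<close>

lemma comp_search:
  assumes "comp_pred (\<lambda>g y. P g (pfst y) (psnd y))"
  shows "\<exists>p. \<forall>g x. run p g x = (if \<exists>n. P g x n then Some (LEAST n. P g x n) else None)"
proof -
  \<comment> \<open>\<open>Mu\<close> searches for a zero, so the program to be tested is the one
    for the negation.\<close>
  have "comp_fun (\<lambda>g y. of_bool (\<not> P g (pfst y) (psnd y)))"
    using comp_pred_not[OF assms] by (simp add: comp_pred_def)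
  then obtain p where p: "\<And>g y. run p g y = Some (of_bool (\<not> P g (pfst y) (psnd y)))"
    unfolding comp_fun_def by blast
  have p': "run p g (prod_encode (x, n)) = Some (of_bool (\<not> P g x n))" for g x n
    using p[of g "pair x n"] by (simp add: pair_def pfst_def psnd_def)
  show ?thesis
    by (intro exI[of _ "Mu p"]) (simp add: p')
qed

lemma comp_fun_Least [comp_intros]:
  assumes "comp_pred (\<lambda>g y. P g (pfst y) (psnd y))" and "\<And>g x. \<exists>n. P g x n"
  shows "comp_fun (\<lambda>g x. LEAST n. P g x n)"
  using comp_search[of P] assms unfolding comp_fun_def by auto

lemma comp_pred_bex [comp_intros]:
  assumes P: "comp_pred (\<lambda>g y. P g (pfst y) (psnd y))" and N: "comp_fun N"
  shows "comp_pred (\<lambda>g x. \<exists>n < N g x. P g x n)"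
proof -
  \<comment> \<open>The disjunct \<open>b \<le> n\<close> makes the search total; its result is
    below \<open>b\<close> exactly if a witness exists.\<close>
  have eq: "(\<exists>n<b. Q n) \<longleftrightarrow> (LEAST n. Q n \<or> b \<le> n) < b" for Q and b :: nat
  proof
    assume "\<exists>n<b. Q n"
    then show "(LEAST n. Q n \<or> b \<le> n) < b"
      by (auto intro: le_less_trans[OF Least_le])
  next
    assume *: "(LEAST n. Q n \<or> b \<le> n) < b"
    have "Q (LEAST n. Q n \<or> b \<le> n) \<or> b \<le> (LEAST n. Q n \<or> b \<le> n)"
      by (rule LeastI[of "\<lambda>n. Q n \<or> b \<le> n" b]) simp
    with * show "\<exists>n<b. Q n" by auto
  qed
  show ?thesis unfolding eq
    by (intro comp_intros P N comp_fun_comp[OF N]) auto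
qed

lemma comp_pred_ball [comp_intros]:
  assumes P: "comp_pred (\<lambda>g y. P g (pfst y) (psnd y))" and N: "comp_fun N"
  shows "comp_pred (\<lambda>g x. \<forall>n < N g x. P g x n)"
proof -
  have "comp_pred (\<lambda>g x. \<not> (\<exists>n < N g x. \<not> P g x n))"
    by (intro comp_intros P N)
  then show ?thesis by simp
qed

lemma comp_fun_div [comp_intros]:
  assumes F: "comp_fun F" and G: "comp_fun G"
  shows "comp_fun (\<lambda>g x. F g x div G g x)"
proof -
  have less: "a < b * Suc q \<longleftrightarrow> a div b \<le> q" if "b > 0" for a b q :: nat
    using that div_less_iff_less_mult[of b a "Suc q"] by (simp add: mult.commute less_Suc_eq_le)
  \<comment> \<open>The disjunct \<open>b = 0\<close> keeps the search total where no quotient could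
    be found; the value \<open>0\<close> is that of division by zero in HOL.\<close>
  have eq: "a div b = (if b = 0 then 0 else LEAST q. b = 0 \<or> a < b * Suc q)" for a b :: nat
    using less[of b a] Least_equality[of "\<lambda>q. b = 0 \<or> a < b * Suc q" "a div b"] by auto
  have ex: "\<exists>q. b = 0 \<or> a < b * Suc q" for a b :: nat
    using less[of b a] by blast
  show ?thesis unfolding eq
    by (intro comp_intros F G comp_fun_comp[OF F] comp_fun_comp[OF G] ex)
qed

lemma comp_fun_mod [comp_intros]:
  fixes F G :: "baire \<Rightarrow> nat \<Rightarrow> nat"
  assumes F: "comp_fun F" and G: "comp_fun G"
  shows "comp_fun (\<lambda>g x. F g x mod G g x)"
  unfolding minus_mult_div_eq_mod[symmetric] by (intro comp_intros F G)

lemma comp_fun_power [comp_intros]: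
  assumes F: "comp_fun F" and G: "comp_fun G"
  shows "comp_fun (\<lambda>g x. F g x ^ G g x)"
proof -
  have eq: "a ^ b = rec_nat 1 (\<lambda>_ r. r * a) b" for a b :: nat
    by (induction b) auto
  show ?thesis unfolding eq by (intro comp_intros F G comp_fun_comp[OF F])
qed

lemma comp_fun_funpow [comp_intros]:
  assumes "comp_fun (\<lambda>g. f)" "comp_fun N" "comp_fun F"
  shows "comp_fun (\<lambda>g x. (f ^^ N g x) (F g x))"
proof -
  have eq: "(f ^^ n) a = rec_nat a (\<lambda>_. f) n" for n a
    by (induction n) auto
  show ?thesis unfolding eq by (intro comp_intros assms comp_fun_comp[OF assms(1)])
qed

lemma comp_pred_odd [comp_intros]: "comp_fun F \<Longrightarrow> comp_pred (\<lambda>g x. odd (F g x))"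
  unfolding odd_iff_mod_2_eq_one by (intro comp_intros)

section \<open>Finite sets given by their binary codes\<close>

lemma comp_pred_mem_set_decode [comp_intros]:
  "comp_fun F \<Longrightarrow> comp_fun G \<Longrightarrow> comp_pred (\<lambda>g x. F g x \<in> set_decode (G g x))"
  unfolding set_decode_def mem_Collect_eq by (intro comp_intros)

lemma comp_fun_set_encode [comp_intros]:
  assumes P: "comp_pred (\<lambda>g y. P g (pfst y) (psnd y))" and N: "comp_fun N"
  shows "comp_fun (\<lambda>g x. set_encode {n. n < N g x \<and> P g x n})"
proof -
  have eq: "set_encode {n. n < b \<and> Q n} = rec_nat 0 (\<lambda>n r. if Q n then r + 2 ^ n else r) b"
    for Q and b :: nat
  proof (induction b)
    case (Suc b)
    have "{n. n < Suc b \<and> Q n} = (if Q b then insert b {n. n < b \<and> Q n} else {n. n < b \<and> Q n})"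
      by (auto simp: less_Suc_eq)
    with Suc show ?case by simp
  qed simp
  have "comp_pred (\<lambda>g y. P g (pfst y) (pfst (psnd y)))"
    by (intro comp_pred_comp2[OF P] comp_intros)
  then show ?thesis unfolding eq by (intro comp_intros N)
qed


section \<open>An effective enumeration of the graph of \<open>phi\<close>\<close>

text \<open>
  \<open>triple e x y\<close> stands for the statement that the program with index \<open>e\<close>, run with the zero oracle
  on \<open>x\<close>, returns \<open>y\<close>. The predicate says that this statement follows from those in \<open>A\<close> by a single
  evaluation step.
\<close>

abbreviation triple :: "nat \<Rightarrow> nat \<Rightarrow> nat \<Rightarrow> nat" where
  "triple e x y \<equiv> pair e (pair x y)"

definition justified :: "nat set \<Rightarrow> nat \<Rightarrow> nat \<Rightarrow> nat \<Rightarrow> bool" where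
  "justified A e x y \<longleftrightarrow>
     (if e < 5 then y = (if e = 1 then Suc x else if e = 2 then pfst x else if e = 3 then psnd x else 0)
      else let m = (e - 5) div 4; r = (e - 5) mod 4; a = pfst m; b = psnd m in
        if r = 0 then triple a x (pfst y) \<in> A \<and> triple b x (psnd y) \<in> A
        else if r = 1 then \<exists>z. triple b x z \<in> A \<and> triple a z y \<in> A
        else if r = 2 then
          if psnd x = 0 then triple a (pfst x) y \<in> A
          else \<exists>z. triple e (pair (pfst x) (psnd x - 1)) z \<in> A \<and>
                 triple b (pair (pfst x) (pair (psnd x - 1) z)) y \<in> A
        else triple m (pair x y) 0 \<in> A \<and> (\<forall>n<y. \<exists>z. triple m (pair x n) (Suc z) \<in> A))"

lemma index_cases [case_names base Tup Comp PrimRec Mu]: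
  fixes e :: nat
  obtains "e < 5" | m where "e = 5 + 4 * m" | m where "e = 6 + 4 * m"
    | m where "e = 7 + 4 * m" | m where "e = 8 + 4 * m"
proof (cases "e < 5")
  case False
  have "e = 5 + 4 * ((e - 5) div 4) + (e - 5) mod 4" "(e - 5) mod 4 < 4"
    using False by auto
  then consider "e = 5 + 4 * ((e - 5) div 4)" | "e = 6 + 4 * ((e - 5) div 4)"
    | "e = 7 + 4 * ((e - 5) div 4)" | "e = 8 + 4 * ((e - 5) div 4)"
    by linarith
  then show ?thesis using that by cases blast+
qed

text \<open>The final \<open>0\<close> covers both \<open>Zero\<close> and \<open>Query\<close>,
  because the oracle is constantly zero.\<close>

lemma justified_base:
  "e < 5 \<Longrightarrow> justified A e x y \<longleftrightarrow>
     y = (if e = 1 then Suc x else if e = 2 then pfst x else if e = 3 then psnd x else 0)"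
  by (simp add: justified_def)

lemma justified_compound:
  "justified A (5 + 4 * m) x y \<longleftrightarrow> triple (pfst m) x (pfst y) \<in> A \<and> triple (psnd m) x (psnd y) \<in> A"
  "justified A (6 + 4 * m) x y \<longleftrightarrow> (\<exists>z. triple (psnd m) x z \<in> A \<and> triple (pfst m) z y \<in> A)"
  "justified A (7 + 4 * m) (pair u 0) y \<longleftrightarrow> triple (pfst m) u y \<in> A"
  "justified A (7 + 4 * m) (pair u (Suc n)) y \<longleftrightarrow>
     (\<exists>z. triple (7 + 4 * m) (pair u n) z \<in> A \<and> triple (psnd m) (pair u (pair n z)) y \<in> A)"
  "justified A (8 + 4 * m) x y \<longleftrightarrow>
     triple m (pair x y) 0 \<in> A \<and> (\<forall>n<y. \<exists>z. triple m (pair x n) (Suc z) \<in> A)"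
proof -
  have "(4 * m + r) div 4 = m" "(4 * m + r) mod 4 = r" if "r < 4" for r
    using that by auto
  from this[of 0] this[of 1] this[of 2] this[of 3]
  show "justified A (5 + 4 * m) x y \<longleftrightarrow> triple (pfst m) x (pfst y) \<in> A \<and> triple (psnd m) x (psnd y) \<in> A"
    "justified A (6 + 4 * m) x y \<longleftrightarrow> (\<exists>z. triple (psnd m) x z \<in> A \<and> triple (pfst m) z y \<in> A)"
    "justified A (7 + 4 * m) (pair u 0) y \<longleftrightarrow> triple (pfst m) u y \<in> A"
    "justified A (7 + 4 * m) (pair u (Suc n)) y \<longleftrightarrow>
       (\<exists>z. triple (7 + 4 * m) (pair u n) z \<in> A \<and> triple (psnd m) (pair u (pair n z)) y \<in> A)"
    "justified A (8 + 4 * m) x y \<longleftrightarrow>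
       triple m (pair x y) 0 \<in> A \<and> (\<forall>n<y. \<exists>z. triple m (pair x n) (Suc z) \<in> A)"
    by (simp_all add: justified_def Let_def add.commute)
qed

lemma pair_0_Suc_cases: obtains u where "x = pair u 0" | u n where "x = pair u (Suc n)"
  by (metis pair_pfst_psnd not0_implies_Suc)

text \<open>\<open>A\<close> occurs only positively in \<open>justified\<close>.\<close>

lemma justified_mono:
  assumes "justified A e x y" "A \<subseteq> B"
  shows "justified B e x y"
proof (cases e rule: index_cases)
  case (PrimRec m)
  with assms show ?thesis
    by (cases x rule: pair_0_Suc_cases) (auto simp: justified_compound)
next
  case (Mu m)
  with assms show ?thesis by (simp add: justified_compound) blast
qed (use assms in \<open>auto simp: justified_base justified_compound\<close>)

section \<open>Computable stages of the derivation\<close>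

lemma mem_set_decode_less: "t \<in> set_decode c \<Longrightarrow> t < c"
proof (rule ccontr)
  assume "t \<in> set_decode c" "\<not> t < c"
  moreover from this have "c < 2 ^ t"
    using less_exp[of t] by linarith
  ultimately show False by (simp add: set_decode_def)
qed

text \<open>Members of a finite set are smaller than its code, and a pair is at least as large as
  its parts. So the code bounds every quantifier over \<open>z\<close> in
  \<open>justified\<close>.\<close>

lemma comp_pred_justified:
  assumes c: "comp_fun C" and e: "comp_fun E" and x: "comp_fun X" and y: "comp_fun Y"
  shows "comp_pred (\<lambda>g n. justified (set_decode (C g n)) (E g n) (X g n) (Y g n))"
proof -
  have bound: "z < c" if "triple e x z \<in> set_decode c \<or> triple e x (Suc z) \<in> set_decode c" for e x z c
    using that le_pair(2)[of z x] le_pair(2)[of "Suc z" x] le_pair(2)[of "pair x z" e]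
      le_pair(2)[of "pair x (Suc z)" e] mem_set_decode_less by (meson Suc_le_lessD le_less_trans less_or_eq_imp_le)
  have ex: "(\<exists>z. triple b x z \<in> set_decode c \<and> P z) \<longleftrightarrow> (\<exists>z<c. triple b x z \<in> set_decode c \<and> P z)"
    "(\<exists>z. triple b x (Suc z) \<in> set_decode c) \<longleftrightarrow> (\<exists>z<c. triple b x (Suc z) \<in> set_decode c)" for b x c P
    using bound by blast+
  show ?thesis unfolding justified_def Let_def ex if_bool_eq_conj
    by (intro comp_intros c e x y comp_fun_comp[OF c] comp_fun_comp[OF e] comp_fun_comp[OF x] comp_fun_comp[OF y])
qed

primrec stage :: "nat \<Rightarrow> nat" where
  "stage 0 = 0"
| "stage (Suc s) = set_encode {t. t < Suc s \<and>
     justified (set_decode (stage s)) (pfst t) (pfst (psnd t)) (psnd (psnd t))}"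

lemma comp_fun_stage [comp_intros]:
  assumes "comp_fun F"
  shows "comp_fun (\<lambda>g x. stage (F g x))"
  unfolding stage_def by (intro comp_intros comp_pred_justified assms)

definition converged :: "nat \<Rightarrow> nat \<Rightarrow> nat \<Rightarrow> nat \<Rightarrow> bool" where
  "converged s e x y \<longleftrightarrow> triple e x y \<in> set_decode (stage s)"

lemma comp_pred_converged [comp_intros]:
  "comp_fun S \<Longrightarrow> comp_fun E \<Longrightarrow> comp_fun X \<Longrightarrow> comp_fun Y \<Longrightarrow>
    comp_pred (\<lambda>g n. converged (S g n) (E g n) (X g n) (Y g n))"
  unfolding converged_def by (intro comp_intros)

lemma converged_0: "\<not> converged 0 e x y"
  by (simp add: converged_def)

lemma set_decode_stage_Suc:
  "set_decode (stage (Suc s)) =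
     {t. t < Suc s \<and> justified (set_decode (stage s)) (pfst t) (pfst (psnd t)) (psnd (psnd t))}"
  by (simp add: set_encode_inverse)

lemma converged_Suc:
  "converged (Suc s) e x y \<longleftrightarrow> triple e x y \<le> s \<and> justified (set_decode (stage s)) e x y"
  by (simp only: converged_def set_decode_stage_Suc mem_Collect_eq less_Suc_eq_le pfst_pair psnd_pair)

text \<open>A stage does not contain its predecessor by definition. Old statements survive because
  their justifications persist by \<open>justified_mono\<close> and the bound only grows.\<close>

lemma stage_mono: "s \<le> s' \<Longrightarrow> set_decode (stage s) \<subseteq> set_decode (stage s')"
proof (rule lift_Suc_mono_le[of "\<lambda>s. set_decode (stage s)"])
  show "set_decode (stage n) \<subseteq> set_decode (stage (Suc n))" for n
  proof (induction n)
    case (Suc n)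
    then show ?case
      unfolding set_decode_stage_Suc using justified_mono by fastforce
  qed simp
qed

lemma converged_mono: "converged s e x y \<Longrightarrow> s \<le> s' \<Longrightarrow> converged s' e x y"
  unfolding converged_def using stage_mono by blast

text \<open>Derivation is finitary: one step has finitely many premises, and by monotonicity they
  all hold at a common stage. For \<open>Mu\<close> their number depends on \<open>y\<close>, so
  that case argues with what holds eventually.\<close>

lemma converged_intro:
  assumes "justified {t. \<exists>s. t \<in> set_decode (stage s)} e x y"
  shows "\<exists>s. converged s e x y"
proof -
  let ?D = "\<lambda>s. set_decode (stage s)"
  have mem: "\<forall>\<^sub>F s in sequentially. t \<in> ?D s" if "t \<in> ?D s" for s t
    using that stage_mono by (auto simp: eventually_sequentially)
  have mem2: "\<exists>s. t \<in> ?D s \<and> t' \<in> ?D s" if "t \<in> ?D s" "t' \<in> ?D s'" for s s' t t'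
    using that stage_mono[of s "max s s'"] stage_mono[of s' "max s s'"]
    by (intro exI[of _ "max s s'"]) auto
  have "\<exists>s. justified (?D s) e x y"
  proof (cases e rule: index_cases)
    case base
    with assms show ?thesis by (simp add: justified_base)
  next
    case (Tup m)
    with assms mem2 show ?thesis by (simp add: justified_compound) blast
  next
    case (Comp m)
    with assms mem2 show ?thesis by (simp add: justified_compound) blast
  next
    case (PrimRec m)
    show ?thesis
    proof (cases x rule: pair_0_Suc_cases)
      case (2 u n)
      with assms mem2 PrimRec show ?thesis by (simp add: justified_compound) blast
    qed (use assms PrimRec in \<open>simp add: justified_compound\<close>)
  next
    case (Mu m)
    have "\<forall>\<^sub>F s in sequentially. \<exists>z. triple m (pair x n) (Suc z) \<in> ?D s" if n: "n < y" for n
    proof -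
      obtain z s where "triple m (pair x n) (Suc z) \<in> ?D s"
        using assms n unfolding Mu justified_compound by blast
      from mem[OF this] show ?thesis by (rule eventually_mono) blast
    qed
    moreover have "\<forall>\<^sub>F s in sequentially. triple m (pair x y) 0 \<in> ?D s"
      using assms unfolding Mu justified_compound by (blast intro: mem)
    ultimately have "\<forall>\<^sub>F s in sequentially. triple m (pair x y) 0 \<in> ?D s \<and>
        (\<forall>n\<in>{..<y}. \<exists>z. triple m (pair x n) (Suc z) \<in> ?D s)"
      by (intro eventually_conj eventually_ball_finite) auto
    then show ?thesis
      unfolding Mu justified_compound eventually_sequentially by auto
  qed
  then obtain s where s: "justified (?D s) e x y" by blast
  \<comment> \<open>Besides its premises, the statement needs a stage beyond its own code.\<close>
  have "converged (Suc (max s (triple e x y))) e x y"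
    unfolding converged_Suc using justified_mono[OF s stage_mono] by simp
  then show ?thesis ..
qed

section \<open>Soundness and completeness of the stages for \<open>phi\<close>\<close>

lemma prog_of_nat_base:
  "prog_of_nat 0 = Zero" "prog_of_nat 1 = Succ" "prog_of_nat (Suc 0) = Succ" "prog_of_nat 2 = Fst"
  "prog_of_nat 3 = Snd" "prog_of_nat 4 = Query"
  by (simp_all add: prog_of_nat.simps)

lemma prog_of_nat_compound':
  "prog_of_nat (5 + 4 * m) = Tup (prog_of_nat (pfst m)) (prog_of_nat (psnd m))"
  "prog_of_nat (6 + 4 * m) = Comp (prog_of_nat (pfst m)) (prog_of_nat (psnd m))"
  "prog_of_nat (7 + 4 * m) = PrimRec (prog_of_nat (pfst m)) (prog_of_nat (psnd m))"
  "prog_of_nat (8 + 4 * m) = Mu (prog_of_nat m)"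
  using prog_of_nat_compound(1-3)[of "pfst m" "psnd m"] prog_of_nat_compound(4)[of m]
  unfolding pair_def[symmetric] pair_pfst_psnd by blast+

lemma run_pair_simps:
  "run Fst g x = Some (pfst x)"
  "run Snd g x = Some (psnd x)"
  "run (Tup p q) g x = Option.bind (run p g x) (\<lambda>a. Option.bind (run q g x) (\<lambda>b. Some (pair a b)))"
  "run (PrimRec p q) g x =
     rec_nat (run p g (pfst x)) (\<lambda>m r. Option.bind r (\<lambda>z. run q g (pair (pfst x) (pair m z)))) (psnd x)"
  "run (Mu p) g x =
     (if \<exists>n. run p g (pair x n) = Some 0 \<and> (\<forall>m<n. run p g (pair x m) \<noteq> None)
      then Some (LEAST n. run p g (pair x n) = Some 0) else None)"
  by (simp_all add: pair_def pfst_def psnd_def split: prod.split)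

declare run.simps(3,4,6,8,9) [simp del] run_pair_simps [simp]

text \<open>Brings the least zero into the form of the \<open>Mu\<close> clause of
  \<open>justified\<close>.\<close>

lemma run_Mu_eq_Some:
  "run (Mu p) g x = Some y \<longleftrightarrow>
     run p g (pair x y) = Some 0 \<and> (\<forall>n<y. \<exists>z. run p g (pair x n) = Some (Suc z))"
proof
  let ?P = "\<lambda>n. run p g (pair x n) = Some 0"
  assume "run (Mu p) g x = Some y"
  then obtain n where n: "?P n" "\<And>m. m < n \<Longrightarrow> run p g (pair x m) \<noteq> None" and y: "y = (LEAST n. ?P n)"
    by (auto split: if_splits)
  have "?P y" "y \<le> n" unfolding y using n(1) by (auto intro: LeastI Least_le)
  moreover have "\<exists>z. run p g (pair x m) = Some (Suc z)" if "m < y" for m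
  proof -
    have "run p g (pair x m) \<noteq> Some 0"
      using that not_less_Least unfolding y by blast
    moreover have "run p g (pair x m) \<noteq> None"
      using n(2) that \<open>y \<le> n\<close> by simp
    ultimately show ?thesis using not0_implies_Suc by fastforce
  qed
  ultimately show "?P y \<and> (\<forall>n<y. \<exists>z. run p g (pair x n) = Some (Suc z))" by blast
next
  assume *: "run p g (pair x y) = Some 0 \<and> (\<forall>n<y. \<exists>z. run p g (pair x n) = Some (Suc z))"
  have "(LEAST n. run p g (pair x n) = Some 0) = y"
  proof (rule Least_equality)
    show "y \<le> n" if "run p g (pair x n) = Some 0" for n
      using that * by (metis leI nat.distinct(1) option.inject)
  qed (use * in blast)
  moreover have "\<exists>n. run p g (pair x n) = Some 0 \<and> (\<forall>m<n. run p g (pair x m) \<noteq> None)"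
    using * by (intro exI[of _ y]) auto
  ultimately show "run (Mu p) g x = Some y" by simp
qed

lemma pair_eq_iff: "pair a b = n \<longleftrightarrow> a = pfst n \<and> b = psnd n"
  by auto

text \<open>Each clause of \<open>justified\<close> mirrors one of \<open>run\<close>, so the graph
  of \<open>phi\<close> is a fixed point of the derivation step.\<close>

lemma justified_phi_iff:
  "justified {t. phi (pfst t) (pfst (psnd t)) = Some (psnd (psnd t))} e x y \<longleftrightarrow> phi e x = Some y"
proof (cases e rule: index_cases)
  case base
  then consider "e = 0" | "e = 1" | "e = 2" | "e = 3" | "e = 4" by linarith
  then show ?thesis
    by cases (auto simp: justified_base phi_def prog_of_nat_base)
next
  case (PrimRec m)
  then show ?thesis
    by (cases x rule: pair_0_Suc_cases)
      (auto simp: justified_compound phi_def prog_of_nat_compound' bind_eq_Some_conv)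
qed (auto simp: justified_compound phi_def prog_of_nat_compound' bind_eq_Some_conv pair_eq_iff
    run_Mu_eq_Some simp del: run_pair_simps(5))

lemma converged_sound: "converged s e x y \<Longrightarrow> phi e x = Some y"
proof (induction s arbitrary: e x y)
  case (Suc s)
  then have "set_decode (stage s) \<subseteq> {t. phi (pfst t) (pfst (psnd t)) = Some (psnd (psnd t))}"
    by (auto simp: converged_def)
  with Suc.prems show ?case
    using justified_mono justified_phi_iff unfolding converged_Suc by blast
qed (simp add: converged_0)

text \<open>Induction on the index, since the premises of a step have smaller indices. The exception
  is \<open>PrimRec\<close>, which refers to itself at a smaller counter and needs an inner
  induction.\<close>

lemma converged_complete: "phi e x = Some y \<Longrightarrow> \<exists>s. converged s e x y"
proof (induction e arbitrary: x y rule: less_induct)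
  case (less e)
  let ?U = "{t. \<exists>s. t \<in> set_decode (stage s)}"
  have U: "triple e x y \<in> ?U" if "justified ?U e x y" for x y
    using converged_intro[OF that] by (simp add: converged_def)
  have IH: "triple a u v \<in> ?U" if "phi a u = Some v" "a < e" for a u v
    using less.IH[OF that(2,1)] by (simp add: converged_def)
  have graph: "justified {t. phi (pfst t) (pfst (psnd t)) = Some (psnd (psnd t))} e x y"
    using less.prems by (simp add: justified_phi_iff)
  show ?case
  proof (cases e rule: index_cases)
    case base
    with graph U[of x y] show ?thesis
      by (simp add: justified_base converged_def)
  next
    case (Tup m)
    then have "pfst m < e" "psnd m < e"
      using pfst_le[of m] psnd_le[of m] by linarith+
    with graph IH have "justified ?U e x y"
      unfolding Tup justified_compound by simp
    from U[OF this] show ?thesis by (simp add: converged_def)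
  next
    case (Comp m)
    then have "pfst m < e" "psnd m < e"
      using pfst_le[of m] psnd_le[of m] by linarith+
    moreover obtain z where "phi (psnd m) x = Some z" "phi (pfst m) z = Some y"
      using graph unfolding Comp justified_compound by auto
    ultimately have "justified ?U e x y"
      using IH unfolding Comp justified_compound by blast
    from U[OF this] show ?thesis by (simp add: converged_def)
  next
    case (PrimRec m)
    then have lt: "pfst m < e" "psnd m < e"
      using pfst_le[of m] psnd_le[of m] by linarith+
    have "triple e (pair u n) v \<in> ?U" if "phi e (pair u n) = Some v" for u n v
      using that
    proof (induction n arbitrary: v)
      case 0
      with IH[OF _ lt(1)] have "justified ?U e (pair u 0) v"
        unfolding justified_phi_iff[symmetric, of e] unfolding PrimRec justified_compound by simp
      then show ?case by (rule U)
    next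
      case (Suc n)
      then obtain z where "phi e (pair u n) = Some z" "phi (psnd m) (pair u (pair n z)) = Some v"
        unfolding justified_phi_iff[symmetric, of e "pair u (Suc n)"]
        unfolding PrimRec justified_compound by auto
      with Suc.IH IH lt have "justified ?U e (pair u (Suc n)) v"
        unfolding PrimRec justified_compound by blast
      then show ?case by (rule U)
    qed
    from this[of "pfst x" "psnd x" y] less.prems show ?thesis
      by (simp add: converged_def)
  next
    case (Mu m)
    then have "m < e" by simp
    with graph IH have "justified ?U e x y"
      unfolding Mu justified_compound by fastforce
    from U[OF this] show ?thesis by (simp add: converged_def)
  qed
qed

lemma phi_eq_Some_iff: "phi e x = Some y \<longleftrightarrow> (\<exists>s. converged s e x y)"
  using converged_sound converged_complete by blast


section \<open>The team of learners\<close>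

definition component :: "nat \<Rightarrow> nat \<Rightarrow> nat" where
  "component l c = pfst ((psnd ^^ l) c)"

definition digit :: "nat \<Rightarrow> nat \<Rightarrow> nat \<Rightarrow> nat" where
  "digit k l z = z div k ^ l mod k"

lemma component_pair [simp]:
  "component 0 (pair a c) = a" "component (Suc l) (pair a c) = component l c"
  by (simp_all add: component_def funpow_swap1)

lemma component_psnd: "component l (psnd c) = component (Suc l) c"
  by (simp add: component_def funpow_swap1)

text \<open>Every number unfolds into an infinite sequence of components, so tuples carry no length.
  This supplies tuples with a prescribed beginning.\<close>

lemma ex_components: "\<exists>c. \<forall>l<n. component l c = f l"
proof (induction n arbitrary: f)
  case (Suc n)
  then obtain c where "\<forall>l<n. component l c = f (Suc l)"
    using Suc.IH[of "\<lambda>l. f (Suc l)"] by (elim exE)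
  then have "\<forall>l<Suc n. component l (pair (f 0) c) = f l"
    by (auto simp: less_Suc_eq_0_disj)
  then show ?case ..
qed simp

lemma digit_div: "digit k l (z div k) = digit k (Suc l) z"
  by (simp add: digit_def div_mult2_eq)

lemma comp_fun_component [comp_intros]:
  "comp_fun L \<Longrightarrow> comp_fun F \<Longrightarrow> comp_fun (\<lambda>g x. component (L g x) (F g x))"
  unfolding component_def by (intro comp_intros)

lemma comp_fun_digit [comp_intros]:
  "comp_fun L \<Longrightarrow> comp_fun F \<Longrightarrow> comp_fun (\<lambda>g x. digit k (L g x) (F g x))"
  unfolding digit_def by (intro comp_intros)

lemma comp_fun_index:
  assumes "comp_fun F"
  shows "\<exists>e. \<forall>g x. run (prog_of_nat e) g x = Some (F g x)"
  using assms surj_prog_of_nat unfolding comp_fun_def by (metis surjD)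

text \<open>The index of \<open>Succ\<close> composed \<open>c\<close> times onto
  \<open>Zero\<close>. An explicit iteration makes it computable in \<open>c\<close>.\<close>

definition const_index :: "nat \<Rightarrow> nat" where
  "const_index c = ((\<lambda>n. 6 + 4 * pair 1 n) ^^ c) 0"

lemma run_const_index [simp]: "run (prog_of_nat (const_index c)) g x = Some c"
  by (induction c) (simp_all add: const_index_def prog_of_nat_compound' prog_of_nat_base)

lemma comp_fun_const_index [comp_intros]:
  "comp_fun F \<Longrightarrow> comp_fun (\<lambda>g x. const_index (F g x))"
  unfolding const_index_def by (intro comp_intros)

text \<open>The s-m-n construction; \<open>5 + 4 * pair 2 3\<close> is the index of
  \<open>Tup Fst Snd\<close>, the identity.\<close>

definition curry_index :: "nat \<Rightarrow> nat \<Rightarrow> nat" where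
  "curry_index e u = 6 + 4 * pair e (5 + 4 * pair (const_index u) (5 + 4 * pair 2 3))"

lemma run_curry_index [simp]:
  "run (prog_of_nat (curry_index e u)) g x = run (prog_of_nat e) g (pair u x)"
  by (simp add: curry_index_def prog_of_nat_compound' prog_of_nat_base)

lemma comp_fun_curry_index [comp_intros]:
  "comp_fun F \<Longrightarrow> comp_fun (\<lambda>g x. curry_index e (F g x))"
  unfolding curry_index_def by (intro comp_intros)

definition add_index :: "nat \<Rightarrow> nat" where
  "add_index k = (SOME e. \<forall>g x. run (prog_of_nat e) g x = Some (pfst x + k * psnd x))"

lemma run_add_index [simp]: "run (prog_of_nat (add_index k)) g x = Some (pfst x + k * psnd x)"
proof -
  have "\<exists>e. \<forall>g x. run (prog_of_nat e) g x = Some (pfst x + k * psnd x)"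
    by (intro comp_fun_index comp_intros)
  from someI_ex[OF this] show ?thesis unfolding add_index_def by blast
qed

text \<open>
  An index of the constant function with value \<open>\<Sum>l<m. k ^ l * phi e\<^sub>l e\<^sub>l\<close>, where \<open>e\<^sub>l\<close> is the
  \<open>l\<close>-th component of the argument.
\<close>

primrec joint_index :: "nat \<Rightarrow> nat \<Rightarrow> nat \<Rightarrow> nat" where
  "joint_index k 0 c = 0"
| "joint_index k (Suc m) c = 6 + 4 * pair (add_index k)
     (5 + 4 * pair (6 + 4 * pair (pfst c) (const_index (pfst c))) (joint_index k m (psnd c)))"

lemma comp_fun_joint_index [comp_intros]:
  "comp_fun F \<Longrightarrow> comp_fun (\<lambda>g x. joint_index k m (F g x))"
proof (induction m arbitrary: F)
  case (Suc m)
  show ?case unfolding joint_index.simps by (intro comp_intros Suc)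
qed (simp add: comp_fun_const)

text \<open>Induction along \<open>z = z mod k + k * (z div k)\<close>: the first component supplies
  the lowest digit, the others supply \<open>z div k\<close>. The bound on \<open>z\<close> ensures
  that \<open>m\<close> digits determine it.\<close>

lemma phi_joint_index:
  assumes "z < k ^ m" and "\<And>l. l < m \<Longrightarrow> phi (component l c) (component l c) = Some (digit k l z)"
  shows "phi (joint_index k m c) x = Some z"
  using assms
proof (induction m arbitrary: c z)
  case 0
  then show ?case by (simp add: phi_def prog_of_nat_base)
next
  case (Suc m)
  have "k > 0" using Suc.prems(1) by (cases k) auto
  then have "z div k < k ^ m"
    using Suc.prems(1) by (simp add: div_less_iff_less_mult mult.commute)
  moreover have "phi (component l (psnd c)) (component l (psnd c)) = Some (digit k l (z div k))"
    if "l < m" for l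
    unfolding component_psnd digit_div using Suc.prems(2) that by simp
  ultimately have "phi (joint_index k m (psnd c)) x = Some (z div k)"
    by (rule Suc.IH)
  moreover have "phi (pfst c) (pfst c) = Some (z mod k)"
    using Suc.prems(2)[of 0] by (simp add: component_def digit_def)
  ultimately show ?case
    by (simp add: phi_def prog_of_nat_compound')
qed

section \<open>Matching tuples and their decoders\<close>

definition matches :: "nat \<Rightarrow> nat \<Rightarrow> nat \<Rightarrow> nat \<Rightarrow> nat \<Rightarrow> baire \<Rightarrow> bool" where
  "matches k m j s c g \<longleftrightarrow> (\<forall>l<m. j \<le> l \<longrightarrow>
     converged s (component l c) (component l c) (digit k l (g (joint_index k m c))))"

definition agree :: "nat \<Rightarrow> nat \<Rightarrow> nat \<Rightarrow> bool" where
  "agree j c u \<longleftrightarrow> (\<forall>i<j. component i c = component i u)"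

lemma comp_pred_agree [comp_intros]:
  assumes F: "comp_fun F" and G: "comp_fun G"
  shows "comp_pred (\<lambda>g x. agree j (F g x) (G g x))"
  unfolding agree_def by (intro comp_intros comp_fun_comp[OF F] comp_fun_comp[OF G])

text \<open>A computable \<open>h\<close> stands in for the oracle, because the learner evaluates
  \<open>matches\<close> on a function read off from the code of a list.\<close>

lemma comp_pred_matches:
  assumes S: "comp_fun S" and F: "comp_fun F" and h: "comp_fun (\<lambda>g x. h g (pfst x) (psnd x))"
  shows "comp_pred (\<lambda>g x. matches k m j (S g x) (F g x) (h g x))"
  unfolding matches_def
  by (intro comp_intros comp_fun_comp[OF F] comp_fun_comp[OF S] comp_fun_comp2[OF h])

lemma matches_mono: "matches k m j s c g \<Longrightarrow> s \<le> s' \<Longrightarrow> matches k m j s' c g"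
  unfolding matches_def using converged_mono by blast

text \<open>If all digits matched, the program with index \<open>e = joint_index k m c\<close> would
  return \<open>g e\<close> on input \<open>e\<close>, which \<open>DNR\<close> excludes.\<close>

lemma not_matches_0:
  assumes "g \<in> DNR (k ^ m)"
  shows "\<not> matches k m 0 s c g"
proof
  let ?e = "joint_index k m c"
  assume match: "matches k m 0 s c g"
  have "g ?e < k ^ m" using assms by (simp add: DNR_def)
  then have "phi ?e ?e = Some (g ?e)"
  proof (rule phi_joint_index)
    show "phi (component l c) (component l c) = Some (digit k l (g ?e))" if "l < m" for l
      using match that converged_sound by (auto simp: matches_def)
  qed
  then show False using assms by (simp add: DNR_def)
qed

text \<open>\<open>y\<close> packs a tuple with a stage, so that a single unbounded search finds
  both.\<close>

definition found :: "nat \<Rightarrow> nat \<Rightarrow> nat \<Rightarrow> nat \<Rightarrow> baire \<Rightarrow> nat \<Rightarrow> nat \<Rightarrow> bool" where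
  "found k m j u g x y \<longleftrightarrow>
     agree j (pfst y) u \<and> component j (pfst y) = x \<and> matches k m (Suc j) (psnd y) (pfst y) g"

definition decoder_index :: "nat \<Rightarrow> nat \<Rightarrow> nat \<Rightarrow> nat" where
  "decoder_index k m j = (SOME e. \<forall>g u x. run (prog_of_nat e) g (pair u x) =
     (if \<exists>y. found k m j u g x y
      then Some (digit k j (g (joint_index k m (pfst (LEAST y. found k m j u g x y))))) else None))"

lemma run_decoder_index:
  "run (prog_of_nat (decoder_index k m j)) g (pair u x) =
     (if \<exists>y. found k m j u g x y
      then Some (digit k j (g (joint_index k m (pfst (LEAST y. found k m j u g x y))))) else None)"
proof -
  \<comment> \<open>Here \<open>w\<close> is the input \<open>pair u x\<close> paired with the
    candidate \<open>y\<close>.\<close>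
  have "comp_pred (\<lambda>g w. found k m j (pfst (pfst w)) g (psnd (pfst w)) (psnd w))"
    unfolding found_def by (intro comp_intros comp_pred_matches)
  from comp_search[OF this] obtain p where p: "\<And>g x. run p g x =
      (if \<exists>y. found k m j (pfst x) g (psnd x) y then Some (LEAST y. found k m j (pfst x) g (psnd x) y)
       else None)"
    by blast
  have "comp_fun (\<lambda>g y. digit k j (g (joint_index k m (pfst y))))"
    by (intro comp_intros)
  then obtain q where q: "\<And>g y. run q g y = Some (digit k j (g (joint_index k m (pfst y))))"
    unfolding comp_fun_def by blast
  obtain e where e: "prog_of_nat e = Comp q p"
    using surj_prog_of_nat by (metis surjD)
  have "\<exists>e. \<forall>g u x. run (prog_of_nat e) g (pair u x) =
     (if \<exists>y. found k m j u g x y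
      then Some (digit k j (g (joint_index k m (pfst (LEAST y. found k m j u g x y))))) else None)"
    by (rule exI[of _ e]) (simp add: e p q)
  from someI_ex[OF this, folded decoder_index_def] show ?thesis
    by (rule allE, elim allE)
qed

text \<open>The hypothesis is \<open>Q (j + 1)\<close>. It is applied to a tuple consisting of the
  first \<open>j\<close> components of \<open>u\<close> followed by \<open>x\<close>; the extension
  obtained makes the search succeed.\<close>

lemma decoder_total:
  assumes "\<And>u. \<exists>c s. agree (Suc j) c u \<and> matches k m (Suc j) s c g"
  shows "\<exists>f. Phi (curry_index (decoder_index k m j) u) g = Some f \<and>
    (\<forall>x. \<exists>y. found k m j u g x y \<and> f x = digit k j (g (joint_index k m (pfst y))))"
proof -
  have ex: "\<exists>y. found k m j u g x y" for x
  proof -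
    obtain v where v: "\<forall>l<Suc j. component l v = (if l = j then x else component l u)"
      using ex_components[of "Suc j" "\<lambda>l. if l = j then x else component l u"] by blast
    obtain c s where "agree (Suc j) c v" "matches k m (Suc j) s c g"
      using assms by blast
    with v have "found k m j u g x (pair c s)"
      by (simp add: found_def agree_def)
    then show ?thesis ..
  qed
  then have "found k m j u g x (LEAST y. found k m j u g x y)" for x
    by (rule LeastI_ex)
  then show ?thesis
    by (intro exI[of _ "\<lambda>x. digit k j (g (joint_index k m (pfst (LEAST y. found k m j u g x y))))"])
      (auto simp: Phi_def run_decoder_index ex)
qed

text \<open>Here \<open>u\<close> witnesses the failure of \<open>Q j\<close>. If
  \<open>phi e e\<close> were the value returned at \<open>e\<close>, the tuple found for
  \<open>e\<close> would match at position \<open>j\<close> too, at a large enough stage.\<close>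

lemma decoder_in_DNR:
  assumes "k > 0" "j < m"
    and "\<And>u. \<exists>c s. agree (Suc j) c u \<and> matches k m (Suc j) s c g"
    and no_match: "\<And>c s. agree j c u \<Longrightarrow> \<not> matches k m j s c g"
  shows "\<exists>f\<in>DNR k. Phi (curry_index (decoder_index k m j) u) g = Some f"
proof -
  obtain f where f: "Phi (curry_index (decoder_index k m j) u) g = Some f"
    "\<And>x. \<exists>y. found k m j u g x y \<and> f x = digit k j (g (joint_index k m (pfst y)))"
    using decoder_total[OF assms(3)] by blast
  have "f x < k" for x
    using f(2)[of x] \<open>k > 0\<close> by (auto simp: digit_def)
  moreover have "phi e e \<noteq> Some (f e)" for e
  proof
    assume "phi e e = Some (f e)"
    then obtain t where t: "converged t e e (f e)"
      using phi_eq_Some_iff by blast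
    obtain y where y: "found k m j u g e y" "f e = digit k j (g (joint_index k m (pfst y)))"
      using f(2) by blast
    let ?s = "max t (psnd y)"
    have "matches k m (Suc j) ?s (pfst y) g"
      using y(1) matches_mono unfolding found_def by (meson max.cobounded2)
    moreover have "converged ?s e e (f e)"
      using t by (rule converged_mono) simp
    ultimately have "matches k m j ?s (pfst y) g"
      using y unfolding matches_def found_def by (metis Suc_leI le_neq_implies_less)
    then show False
      using no_match y(1) unfolding found_def by blast
  qed
  ultimately show ?thesis
    using f(1) by (auto simp: DNR_def)
qed

section \<open>Learning a witness in the limit\<close>

definition refuted :: "nat \<Rightarrow> nat \<Rightarrow> nat \<Rightarrow> baire \<Rightarrow> nat \<Rightarrow> nat \<Rightarrow> bool" where
  "refuted k m j g n u \<longleftrightarrow>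
     (\<exists>c<n. joint_index k m c < n \<and> agree j c u \<and> matches k m j n c g)"

text \<open>The guess is the least parameter not refuted so far; the disjunct
  \<open>length \<sigma> \<le> u\<close> caps the search, so that it always ends.\<close>

definition conjecture :: "nat \<Rightarrow> nat \<Rightarrow> nat \<Rightarrow> nat list \<Rightarrow> nat" where
  "conjecture k m j \<sigma> = curry_index (decoder_index k m j)
     (LEAST u. length \<sigma> \<le> u \<or> \<not> refuted k m j (\<lambda>i. \<sigma> ! i) (length \<sigma>) u)"

text \<open>Refutations at \<open>n\<close> query the oracle only at
  \<open>joint_index k m c < n\<close>, so an initial segment of length \<open>n\<close> decides
  them.\<close>

lemma refuted_cong:
  assumes "\<And>i. i < n \<Longrightarrow> g i = h i"
  shows "refuted k m j g n = refuted k m j h n"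
  using assms unfolding refuted_def matches_def fun_eq_iff by (auto intro!: ex_cong)

text \<open>Code \<open>0\<close>, i.e. \<open>[]\<close>, is mapped to itself, because \<open>prod_decode 0 = (0, 0)\<close>.\<close>

definition tl_code :: "nat \<Rightarrow> nat" where
  "tl_code c = psnd (c - 1)"

lemma tl_code_list_encode: "tl_code (list_encode \<sigma>) = list_encode (tl \<sigma>)"
  by (cases \<sigma>) (use psnd_le[of 0] in \<open>simp_all add: tl_code_def psnd_def\<close>)

lemma tl_code_funpow: "(tl_code ^^ n) (list_encode \<sigma>) = list_encode (drop n \<sigma>)"
proof (induction n)
  case (Suc n)
  then show ?case by (simp add: tl_code_list_encode tl_drop drop_Suc)
qed simp

lemma list_encode_eq_0_iff: "list_encode \<sigma> = 0 \<longleftrightarrow> \<sigma> = []"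
  by (cases \<sigma>) auto

lemma length_via_code: "length \<sigma> = (LEAST n. (tl_code ^^ n) (list_encode \<sigma>) = 0)"
  unfolding tl_code_funpow list_encode_eq_0_iff drop_eq_Nil2
  by (rule Least_equality[symmetric]) auto

lemma nth_via_code:
  assumes "i < length \<sigma>"
  shows "\<sigma> ! i = pfst ((tl_code ^^ i) (list_encode \<sigma>) - 1)"
proof -
  have "drop i \<sigma> = \<sigma> ! i # drop (Suc i) \<sigma>"
    using assms by (simp add: Cons_nth_drop_Suc)
  then show ?thesis by (simp add: tl_code_funpow pfst_def)
qed

lemma comp_fun_learner:
  assumes "comp_fun (\<lambda>_. F)"
  shows "learner (\<lambda>\<sigma>. F (list_encode \<sigma>))"
  using comp_fun_index[OF assms] by (auto simp: learner_def phi_def)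

lemma learner_const: "learner (\<lambda>_. c)"
  by (rule comp_fun_learner) (rule comp_fun_const)

text \<open>A learner receives the code of a list. Iterating \<open>tl_code\<close> recovers length
  and entries, which turns the conjecture into a function \<open>F\<close> of the code.\<close>

lemma learner_conjecture: "learner (conjecture k m j)"
proof -
  define len where "len w = (LEAST n. (tl_code ^^ n) w = 0)" for w
  define nth where "nth w i = pfst ((tl_code ^^ i) w - 1)" for w i
  define F where "F w = curry_index (decoder_index k m j)
     (LEAST u. len w \<le> u \<or> \<not> refuted k m j (nth w) (len w) u)" for w
  have tl: "comp_fun (\<lambda>_. tl_code)"
    unfolding tl_code_def by (intro comp_intros)
  have ex: "\<exists>n. (tl_code ^^ n) w = 0" for w
    using tl_code_funpow[of "length (list_decode w)" "list_decode w"] by auto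
  have len: "comp_fun (\<lambda>_ w. len w)"
    unfolding len_def by (intro comp_intros comp_fun_comp[OF tl] ex)
  have nth: "comp_fun (\<lambda>_ w. nth (pfst w) (psnd w))"
    unfolding nth_def by (intro comp_intros comp_fun_comp[OF tl])
  have "comp_fun (\<lambda>_. F)"
    unfolding F_def refuted_def
    by (intro comp_intros comp_pred_matches comp_fun_comp[OF len] comp_fun_comp2[OF nth]) auto
  moreover have "conjecture k m j \<sigma> = F (list_encode \<sigma>)" for \<sigma>
    unfolding conjecture_def F_def len_def length_via_code[symmetric]
    by (simp add: nth_def nth_via_code cong: refuted_cong)
  ultimately show ?thesis
    using comp_fun_learner[of F] by presburger
qed

text \<open>The limit belongs to the least good parameter \<open>v\<close>: each smaller one is
  refuted from some point on, since refutations persist, and \<open>v\<close> never is. Once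
  \<open>n\<close> exceeds \<open>v\<close>, the cap on the search has no effect.\<close>

lemma conjecture_limit:
  assumes "\<exists>u. \<forall>c s. agree j c u \<longrightarrow> \<not> matches k m j s c g"
  shows "\<exists>u. (\<forall>c s. agree j c u \<longrightarrow> \<not> matches k m j s c g) \<and>
    (\<lambda>n. conjecture k m j (g \<restriction> n)) \<longlonglongrightarrow> curry_index (decoder_index k m j) u"
proof -
  let ?good = "\<lambda>u. \<forall>c s. agree j c u \<longrightarrow> \<not> matches k m j s c g"
  define v where "v = (LEAST u. ?good u)"
  have good: "?good v" unfolding v_def using assms by (rule LeastI_ex)
  have "\<forall>\<^sub>F n in sequentially. refuted k m j g n u" if u: "u < v" for u
  proof -
    obtain c s where cs: "agree j c u" "matches k m j s c g"
      using not_less_Least[OF u[unfolded v_def]] by blast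
    have "refuted k m j g n u" if "n > max c (max s (joint_index k m c))" for n
      unfolding refuted_def using that cs(1) matches_mono[OF cs(2), of n] by (intro exI[of _ c]) auto
    with eventually_gt_at_top show ?thesis by (rule eventually_mono)
  qed
  then have "\<forall>\<^sub>F n in sequentially. n > v \<and> (\<forall>u\<in>{..<v}. refuted k m j g n u)"
    by (intro eventually_conj eventually_gt_at_top eventually_ball_finite) auto
  then have "\<forall>\<^sub>F n in sequentially. conjecture k m j (g \<restriction> n) = curry_index (decoder_index k m j) v"
  proof (rule eventually_mono)
    fix n assume n: "n > v \<and> (\<forall>u\<in>{..<v}. refuted k m j g n u)"
    have "\<not> refuted k m j g n v"
      using good unfolding refuted_def by blast
    with n have "(LEAST u. n \<le> u \<or> \<not> refuted k m j g n u) = v"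
      by (intro Least_equality) (auto intro: leI)
    moreover have "refuted k m j (\<lambda>i. (g \<restriction> n) ! i) n = refuted k m j g n"
      by (rule refuted_cong) (simp add: initial_seg_def)
    ultimately show "conjecture k m j (g \<restriction> n) = curry_index (decoder_index k m j) v"
      by (simp add: conjecture_def initial_seg_def)
  qed
  then show ?thesis
    by (intro exI[of _ v] conjI good tendsto_eventually)
qed

text \<open>
  For \<open>j = 0\<close> all conjectures \<open>u\<close> are equally good, so a constant learner suffices; unlike
  \<open>conjecture k m 0\<close>, it converges on every oracle.
\<close>

definition team_learner :: "nat \<Rightarrow> nat \<Rightarrow> nat \<Rightarrow> nat list \<Rightarrow> nat" where
  "team_learner k m j =
     (if j = 0 then (\<lambda>_. curry_index (decoder_index k m 0) 0) else conjecture k m j)"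

lemma learner_team_learner: "learner (team_learner k m j)"
  by (simp add: team_learner_def learner_const learner_conjecture)

lemma confident_team_learner: "confident (team_learner k m 0)"
  by (simp add: team_learner_def confident_def convergent_const)

lemma team_learner_succeeds:
  assumes "k > 0" "g \<in> DNR (k ^ m)"
  shows "\<exists>j<m. convergent (\<lambda>n. team_learner k m j (g \<restriction> n)) \<and>
    (\<exists>f\<in>DNR k. Phi (lim (\<lambda>n. team_learner k m j (g \<restriction> n))) g = Some f)"
proof -
  let ?Q = "\<lambda>j. \<forall>u. \<exists>c s. agree j c u \<and> matches k m j s c g"
  \<comment> \<open>No position is left to match, so \<open>c = u\<close> will do.\<close>
  have "?Q m" by (auto simp: agree_def matches_def)
  moreover have "\<not> ?Q 0" using not_matches_0[OF assms(2)] by blast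
  ultimately obtain j where j: "j < m" "\<not> ?Q j" "?Q (Suc j)"
    using ex_least_nat_less[of ?Q m] by (metis lessI less_imp_le_nat linorder_not_less not_less_eq)
  have "\<exists>u. (\<forall>c s. agree j c u \<longrightarrow> \<not> matches k m j s c g) \<and>
    (\<lambda>n. team_learner k m j (g \<restriction> n)) \<longlonglongrightarrow> curry_index (decoder_index k m j) u"
  proof (cases "j = 0")
    case True
    then show ?thesis
      using not_matches_0[OF assms(2)] by (auto simp: team_learner_def)
  next
    case False
    then show ?thesis
      using conjecture_limit[of j k m g] j(2) by (auto simp: team_learner_def)
  qed
  then obtain u where u: "\<And>c s. agree j c u \<Longrightarrow> \<not> matches k m j s c g"
    and lim: "(\<lambda>n. team_learner k m j (g \<restriction> n)) \<longlonglongrightarrow> curry_index (decoder_index k m j) u"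
    by blast
  show ?thesis
    using decoder_in_DNR[OF assms(1) j(1) _ u] j(1,3) lim limI[OF lim]
    by (intro exI[of _ j]) (auto simp: convergent_def)
qed

text \<open>Beyond the last position there is nothing to match, so the decoder halts for every
  oracle and every parameter.\<close>

lemma eventually_popperian_team_learner: "eventually_popperian (team_learner k (Suc (Suc j)) (Suc j))"
proof -
  let ?\<Psi> = "team_learner k (Suc (Suc j)) (Suc j)"
  have "f \<in> dom (Phi (lim (\<lambda>n. ?\<Psi> (f \<restriction> n))))" if conv: "convergent (\<lambda>n. ?\<Psi> (f \<restriction> n))" for f
  proof -
    have "\<forall>\<^sub>F n in sequentially. ?\<Psi> (f \<restriction> n) = lim (\<lambda>n. ?\<Psi> (f \<restriction> n))"
      using conv by (simp add: convergent_LIMSEQ_iff tendsto_discrete)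
    \<comment> \<open>A convergent sequence of naturals attains its limit, so the limit is itself an
      index of a decoder with fixed parameter.\<close>
    then obtain n where "lim (\<lambda>n. ?\<Psi> (f \<restriction> n)) = ?\<Psi> (f \<restriction> n)"
      unfolding eventually_sequentially by (metis order_refl)
    then obtain u where "lim (\<lambda>n. ?\<Psi> (f \<restriction> n)) = curry_index (decoder_index k (Suc (Suc j)) (Suc j)) u"
      by (auto simp: team_learner_def conjecture_def)
    moreover have "\<exists>c s. agree (Suc (Suc j)) c u \<and> matches k (Suc (Suc j)) (Suc (Suc j)) s c f" for u
      by (auto simp: agree_def matches_def)
    ultimately show ?thesis
      using decoder_total[of "Suc j" k "Suc (Suc j)" f u] by auto
  qed
  then show ?thesis unfolding eventually_popperian_def by blast
qed

section \<open>Reductions between the classes \<open>DNR k\<close>\<close>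

lemma team_le_intro:
  assumes "finite L" "L \<subseteq> Collect learner"
    and "\<And>g. g \<in> B \<Longrightarrow> \<exists>\<Psi>\<in>L. convergent (\<lambda>n. \<Psi> (g \<restriction> n)) \<and>
      (\<exists>f\<in>A. Phi (lim (\<lambda>n. \<Psi> (g \<restriction> n))) g = Some f)"
  shows "A \<le>\<^bsup><\<omega>\<^esup>\<^sub>\<omega> B"
proof -
  obtain \<Psi> f where \<Psi>: "\<And>g. g \<in> B \<Longrightarrow> \<Psi> g \<in> L \<and> convergent (\<lambda>n. \<Psi> g (g \<restriction> n)) \<and>
      f g \<in> A \<and> Phi (lim (\<lambda>n. \<Psi> g (g \<restriction> n))) g = Some (f g)"
    using assms(3) by metis
  \<comment> \<open>Team computability asks nothing effective of \<open>?\<Gamma>\<close> itself, so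
    the results chosen for the single \<open>g\<close> may be glued together, with domain exactly
    \<open>B\<close>.\<close>
  let ?\<Gamma> = "\<lambda>g. if g \<in> B then Some (f g) else None"
  have "team_computable ?\<Gamma>"
    unfolding team_computable_iff_finite using assms(1,2) \<Psi>
    by (intro exI[of _ L]) (fastforce split: if_splits)
  then show ?thesis
    unfolding reducible_via_def using \<Psi> by (intro exI[of _ ?\<Gamma>]) (auto split: if_splits)
qed

lemma team_le_DNR_power:
  assumes "m > 0"
  shows "DNR k \<le>\<^bsup><\<omega>\<^esup>\<^sub>\<omega> DNR (k ^ m)"
proof (rule team_le_intro)
  show "finite (team_learner k m ` {..<m})" by simp
  show "team_learner k m ` {..<m} \<subseteq> Collect learner"
    using learner_team_learner by blast
  fix g assume g: "g \<in> DNR (k ^ m)"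
  then have "g 0 < k ^ m" by (simp add: DNR_def)
  \<comment> \<open>For \<open>k = 0\<close> the bound \<open>0 ^ m\<close> would be
    \<open>0\<close>, leaving \<open>g\<close> no value.\<close>
  then have "k > 0" using assms by (cases k) (auto simp: zero_power)
  from team_learner_succeeds[OF this g]
  show "\<exists>\<Psi>\<in>team_learner k m ` {..<m}. convergent (\<lambda>n. \<Psi> (g \<restriction> n)) \<and>
      (\<exists>f\<in>DNR k. Phi (lim (\<lambda>n. \<Psi> (g \<restriction> n))) g = Some f)"
    by blast
qed

lemma DNR_mono: "k \<le> l \<Longrightarrow> DNR k \<subseteq> DNR l"
  by (auto simp: DNR_def intro: less_le_trans)

lemma reducible_via_mono:
  "reducible_via C A B \<Longrightarrow> A \<subseteq> A' \<Longrightarrow> B' \<subseteq> B \<Longrightarrow> reducible_via C A' B'"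
  unfolding reducible_via_def by blast

lemma team_equiv_DNR:
  assumes "k \<ge> 2"
  shows "DNR k \<equiv>\<^bsup><\<omega>\<^esup>\<^sub>\<omega> DNR 2"
proof
  show "DNR k \<le>\<^bsup><\<omega>\<^esup>\<^sub>\<omega> DNR 2"
    \<comment> \<open>Exponent \<open>1\<close> reduces \<open>DNR 2\<close> to itself; the left
      side is then enlarged to \<open>DNR k\<close>.\<close>
    using team_le_DNR_power[of 1 2] DNR_mono[OF assms] by (auto intro: reducible_via_mono)
  have "DNR 2 \<le>\<^bsup><\<omega>\<^esup>\<^sub>\<omega> DNR (2 ^ k)"
    using assms by (intro team_le_DNR_power) simp
  moreover have "DNR k \<subseteq> DNR (2 ^ k)"
    by (intro DNR_mono less_imp_le less_exp)
  ultimately show "DNR 2 \<le>\<^bsup><\<omega>\<^esup>\<^sub>\<omega> DNR k"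
    by (rule reducible_via_mono[OF _ order_refl])
qed

text \<open>The limit of a successful learner is an index of a Turing reduction.\<close>

lemma team_computable_imp_nonuniformly_computable:
  assumes "team_computable \<Gamma>"
  shows "nonuniformly_computable \<Gamma>"
  unfolding nonuniformly_computable_def
proof
  fix g assume g: "g \<in> dom \<Gamma>"
  with assms obtain i where "Phi i g = \<Gamma> g"
    unfolding team_computable_def by blast
  with g show "the (\<Gamma> g) \<le>\<^sub>T g"
    unfolding turing_le_def by (intro exI[of _ i]) auto
qed

lemma team_le_imp_nonuniform_le: "A \<le>\<^bsup><\<omega>\<^esup>\<^sub>\<omega> B \<Longrightarrow> A \<le>\<^sup>\<omega>\<^sub>1 B"
  unfolding reducible_via_def using team_computable_imp_nonuniformly_computable by blast

theorem corollary72: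
  "(\<forall>k\<ge>2. DNR k \<equiv>\<^bsup><\<omega>\<^esup>\<^sub>\<omega> DNR 2) \<and>
   (\<forall>k. DNR k \<le>\<^bsup><\<omega>\<^esup>\<^sub>\<omega> DNR (k\<^sup>2) \<and>
        (\<exists>\<Psi>\<^sub>0 \<Psi>\<^sub>1.
           learner \<Psi>\<^sub>0 \<and> confident \<Psi>\<^sub>0 \<and>
           learner \<Psi>\<^sub>1 \<and> eventually_popperian \<Psi>\<^sub>1 \<and>
           (\<forall>g\<in>DNR (k\<^sup>2). \<exists>\<Psi>\<in>{\<Psi>\<^sub>0, \<Psi>\<^sub>1}.
              convergent (\<lambda>n. \<Psi> (g \<restriction> n)) \<and>
              (\<exists>f\<in>DNR k. Phi (lim (\<lambda>n. \<Psi> (g \<restriction> n))) g = Some f)))) \<and>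
   (\<forall>k\<ge>2. DNR k \<equiv>\<^sup>\<omega>\<^sub>1 DNR 2)"
proof (intro conjI allI impI)
  fix k :: nat
  show "DNR k \<le>\<^bsup><\<omega>\<^esup>\<^sub>\<omega> DNR (k\<^sup>2)"
    by (rule team_le_DNR_power) simp
  have "\<exists>\<Psi>\<in>{team_learner k 2 0, team_learner k 2 1}. convergent (\<lambda>n. \<Psi> (g \<restriction> n)) \<and>
      (\<exists>f\<in>DNR k. Phi (lim (\<lambda>n. \<Psi> (g \<restriction> n))) g = Some f)" if g: "g \<in> DNR (k\<^sup>2)" for g
  proof -
    \<comment> \<open>\<open>DNR (k\<^sup>2)\<close> is empty for \<open>k = 0\<close>.\<close>
    have "k > 0" using g by (auto simp: DNR_def intro!: Nat.gr0I)
    from team_learner_succeeds[OF this g] show ?thesis by (auto simp: less_2_cases_iff)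
  qed
  then show "\<exists>\<Psi>\<^sub>0 \<Psi>\<^sub>1. learner \<Psi>\<^sub>0 \<and> confident \<Psi>\<^sub>0 \<and> learner \<Psi>\<^sub>1 \<and> eventually_popperian \<Psi>\<^sub>1 \<and>
      (\<forall>g\<in>DNR (k\<^sup>2). \<exists>\<Psi>\<in>{\<Psi>\<^sub>0, \<Psi>\<^sub>1}. convergent (\<lambda>n. \<Psi> (g \<restriction> n)) \<and>
        (\<exists>f\<in>DNR k. Phi (lim (\<lambda>n. \<Psi> (g \<restriction> n))) g = Some f))"
    \<comment> \<open>The instance \<open>j = 0\<close> is the learner for position \<open>1\<close>
      with \<open>m = 2\<close>.\<close>
    using learner_team_learner confident_team_learner eventually_popperian_team_learner[of k 0]
    by (intro exI[of _ "team_learner k 2 0"] exI[of _ "team_learner k 2 1"])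
      (simp add: numeral_2_eq_2)
qed (use team_equiv_DNR team_le_imp_nonuniform_le in blast)+

end
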